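(* Consider the two-shop ski rental problem with renting prices $1=r_1<r_2$ and buying prices $b_1>b_2>0$, with $r_2<b_2$, and let $\lambda\in(1/b_2,1)$. Let $x$ be the actual number of skiing days, $y$ the predicted number, and $\zeta=|y-x|$. Consider the randomized algorithm that, given $y$: - if $y\ge b_2$, sets $k=\lfloor\lambda b_2\rfloor$, draws $j\in\{1,\dots,k\}$ at random with $\Pr[j=i]=p_i$, where $$p_i=\left(\frac{b_2-r_2}{b_2}\right)^{k-i}\cdot\frac{r_2}{b_2\left(1-\left(1-\frac{r_2}{b_2}\right)^{k}\right)},\qquad i=1,\dots,k,$$ rents at shop $2$ till day $j-1$ and then buys at shop $2$ on day $j$; - otherwise, sets $l=\left\lceil\frac{b_1}{\lambda}\right\rceil$, draws $j\in\{1,\dots,l\}$ at random with $\Pr[j=i]=q_i$, where $$q_i=\left(\frac{b_1-1}{b_1}\right)^{l-i}\cdot\frac{1}{b_1\left(1-\left(1-\frac{1}{b_1}\right)^{l}\right)},\qquad i=1,\dots,l,$$ rents at shop $1$ till day $j-1$ and then buys at shop $1$ on day $j$. Then the competitive ratio of this algorithm is at most $$\min\left\{\frac{r_2\lambda}{1-e^{-r_2\lambda}}\left(1+\frac{\zeta}{\mathrm{OPT}}\right),\ \ \frac{b_1}{b_2}\max\left\{\frac{r_2}{1-e^{-r_2(\lambda-1/b_2)}},\ \frac{1/\lambda+1/b_1}{1-e^{-1/\lambda}}\right\}\right\},$$ that is, $\mathbb{E}[\mathrm{ALG}]/\mathrm{OPT}$ is at most this quantity for all $x$ and $y$. In particular,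 the algorithm is $\left(\frac{r_2\lambda}{1-e^{-r_2\lambda}}\right)$-consistent and $\left(\frac{b_1}{b_2}\max\left\{\frac{r_2}{1-e^{-r_2(\lambda-1/b_2)}},\frac{1/\lambda+1/b_1}{1-e^{-1/\lambda}}\right\}\right)$-robust.
   Context: A skier skis for an unknown positive integer number $x$ of days. Shop $j\in\{1,2\}$ rents skis for $r_j$ dollars per day and sells them for $b_j$ dollars. The skier must choose one shop at the beginning and then rent or buy only at that shop. Choosing shop $s$ and buying day $d\in\{1,2,\dots\}$ costs $x\,r_s$ if $x<d$ and $(d-1)r_s+b_s$ if $x\ge d$. $\mathrm{ALG}$ is the (random) cost of the algorithm; $\mathrm{OPT}=\min\{x,b_2\}$ is the offline optimal cost (with $x$ known). The prediction $y$ is a real number given to the algorithm; $\zeta=|y-x|$ is the prediction error, unknown to the algorithm. The expectation is over the random choice of $j$, with $x$ and $y$ fixed. A randomized algorithm is $\alpha$-consistent if $\mathbb{E}[\mathrm{ALG}]\le\alpha\cdot\mathrm{OPT}$ whenever $\zeta=0$, and $\beta$-robust if $\mathbb{E}[\mathrm{ALG}]\le\beta\cdot\mathrm{OPT}$ for all $x$ and $y$ (hence all $\zeta$). *)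

theory Defs
  imports "HOL-Probability.Probability"
begin

datatype shop = Shop1 | Shop2

text \<open>A deterministic strategy: the chosen shop and the day (counted from 1) on which to buy.\<close>

type_synonym strategy = "shop \<times> nat"

text \<open>A randomized algorithm maps the prediction to a distribution over strategies.\<close>

type_synonym algorithm = "real \<Rightarrow> strategy pmf"

definition cost :: "(shop \<Rightarrow> real) \<Rightarrow> (shop \<Rightarrow> real) \<Rightarrow> nat \<Rightarrow> strategy \<Rightarrow> real" where
  "cost r b x = (\<lambda>(s, d). if x < d then real x * r s else (real d - 1) * r s + b s)"

definition opt :: "(shop \<Rightarrow> real) \<Rightarrow> nat \<Rightarrow> real" where
  "opt b x = min (real x) (b Shop2)"

definition expected_cost ::
    "(shop \<Rightarrow> real) \<Rightarrow> (shop \<Rightarrow> real) \<Rightarrow> algorithm \<Rightarrow> nat \<Rightarrow> real \<Rightarrow> real" where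
  "expected_cost r b A x y = measure_pmf.expectation (A y) (cost r b x)"

definition pred_error :: "nat \<Rightarrow> real \<Rightarrow> real" where
  "pred_error x y = \<bar>y - real x\<bar>"

definition consistent :: "(shop \<Rightarrow> real) \<Rightarrow> (shop \<Rightarrow> real) \<Rightarrow> algorithm \<Rightarrow> real \<Rightarrow> bool" where
  "consistent r b A \<alpha> \<longleftrightarrow>
     (\<forall>x\<ge>1. \<forall>y. pred_error x y = 0 \<longrightarrow> expected_cost r b A x y \<le> \<alpha> * opt b x)"

definition robust :: "(shop \<Rightarrow> real) \<Rightarrow> (shop \<Rightarrow> real) \<Rightarrow> algorithm \<Rightarrow> real \<Rightarrow> bool" where
  "robust r b A \<beta> \<longleftrightarrow> (\<forall>x\<ge>1. \<forall>y. expected_cost r b A x y \<le> \<beta> * opt b x)"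

definition day_weight :: "real \<Rightarrow> real \<Rightarrow> nat \<Rightarrow> nat \<Rightarrow> real" where
  "day_weight rent price n i = ((price - rent) / price) ^ (n - i) * (rent / (price * (1 - (1 - rent / price) ^ n)))"

text \<open>The weights sum to 1 when \<^prop>\<open>0 < rent\<close>, \<^prop>\<open>rent < price\<close> and \<^prop>\<open>1 \<le> n\<close> (lemma
  \<open>sum_day_weight\<close> below); outside this range the distribution is unspecified.\<close>

definition day_pmf :: "real \<Rightarrow> real \<Rightarrow> nat \<Rightarrow> nat pmf" where
  "day_pmf rent price n = embed_pmf (\<lambda>i. if i \<in> {1..n} then day_weight rent price n i else 0)"

definition ski_alg :: "(shop \<Rightarrow> real) \<Rightarrow> (shop \<Rightarrow> real) \<Rightarrow> real \<Rightarrow> algorithm" where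
  "ski_alg r b lam y =
     (if y \<ge> b Shop2
      then map_pmf (Pair Shop2) (day_pmf (r Shop2) (b Shop2) (nat \<lfloor>lam * b Shop2\<rfloor>))
      else map_pmf (Pair Shop1) (day_pmf 1 (b Shop1) (nat \<lceil>b Shop1 / lam\<rceil>)))"

lemma day_weight_nonneg:
  assumes "0 < rent" "rent < price"
  shows "0 \<le> day_weight rent price n i"
proof -
  have "(1 - rent / price) ^ n \<le> 1"
    using assms by (intro power_le_one) (auto simp: field_simps)
  with assms show ?thesis
    by (simp add: day_weight_def)
qed

lemma sum_day_weight:
  assumes "0 < rent" "rent < price" "1 \<le> n"
  shows "(\<Sum>i=1..n. day_weight rent price n i) = 1"
proof -
  define c where "c = 1 - rent / price"
  have c: "0 < c" "c < 1" "rent / price = 1 - c" "(price - rent) / price = c"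
    using assms by (auto simp: c_def field_simps)
  have cn: "c ^ n < 1"
    using c assms(3) power_strict_decreasing[of 0 n c] by simp
  have "(\<Sum>i=1..n. c ^ (n - i)) = (\<Sum>i<n. c ^ i)"
    by (rule sum.reindex_bij_witness[of _ "\<lambda>i. n - i" "\<lambda>i. n - i"]) auto
  also have "\<dots> = (1 - c ^ n) / (1 - c)"
    using c by (simp add: sum_gp_strict)
  finally have *: "(\<Sum>i=1..n. c ^ (n - i)) = (1 - c ^ n) / (1 - c)" .
  have "day_weight rent price n i = c ^ (n - i) * ((1 - c) / (1 - c ^ n))" for i
    using c by (simp add: day_weight_def c_def[symmetric] flip: c(3))
  then have "(\<Sum>i=1..n. day_weight rent price n i) = (1 - c ^ n) / (1 - c) * ((1 - c) / (1 - c ^ n))"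
    by (simp only: * flip: sum_distrib_right)
  then show ?thesis
    using c cn by simp
qed

lemma pmf_day_pmf:
  assumes "0 < rent" "rent < price" "1 \<le> n"
  shows "pmf (day_pmf rent price n) i = (if i \<in> {1..n} then day_weight rent price n i else 0)"
  unfolding day_pmf_def
proof (rule pmf_embed_pmf)
  let ?f = "\<lambda>i. if i \<in> {1..n} then day_weight rent price n i else 0"
  show "0 \<le> ?f i" for i
    using day_weight_nonneg[OF assms(1,2)] by simp
  have "(\<integral>\<^sup>+ i. ennreal (?f i) \<partial>count_space UNIV) = (\<Sum>i\<in>{1..n}. ennreal (?f i))"
    by (rule nn_integral_count_space') auto
  also have "\<dots> = (\<Sum>i\<in>{1..n}. ennreal (day_weight rent price n i))"
    by (rule sum.cong) auto
  also have "\<dots> = ennreal (\<Sum>i\<in>{1..n}. day_weight rent price n i)"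
    using day_weight_nonneg[OF assms(1,2)] by (simp add: sum_ennreal)
  also have "\<dots> = 1"
    using sum_day_weight[OF assms] by simp
  finally show "(\<integral>\<^sup>+ i. ennreal (?f i) \<partial>count_space UNIV) = 1" .
qed

text \<open>Under the standing price assumptions \<^const>\<open>opt\<close> is the least cost of a strategy.\<close>

lemma opt_optimal:
  assumes "r Shop1 = 1" "1 < r Shop2" "b Shop2 < b Shop1" "0 < b Shop2" "1 \<le> x"
  shows "\<exists>s d. 1 \<le> d \<and> cost r b x (s, d) = opt b x"
    and "1 \<le> d \<Longrightarrow> opt b x \<le> cost r b x (s, d)"
proof -
  have "cost r b x (Shop1, Suc x) = real x" "cost r b x (Shop2, 1) = b Shop2"
    using assms by (auto simp: cost_def)
  then show "\<exists>s d. 1 \<le> d \<and> cost r b x (s, d) = opt b x"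
    unfolding opt_def min_def by (metis le_add1 order_refl plus_1_eq_Suc)
next
  assume d: "1 \<le> d"
  have r: "1 \<le> r s" and b: "b Shop2 \<le> b s"
    using assms by (cases s; simp)+
  have "real x * 1 \<le> real x * r s" "0 \<le> (real d - 1) * r s"
    using r d by (intro mult_left_mono mult_nonneg_nonneg; simp)+
  with b show "opt b x \<le> cost r b x (s, d)"
    by (auto simp: opt_def cost_def)
qed

end

theory Submission
  imports Defs
begin

text \<open>The weights make the expected cost linear in the number of days until it saturates: with \<open>n\<close>
  possible buying days it equals \<open>rent * min x n / (1 - (1 - rent / price)^n)\<close>, and
  \<open>(1 - rent / price)^n \<le> exp (- rent * n / price)\<close>. Robustness then only needs the bounds on \<open>n\<close>
  given by rounding. For the error-dependent bound, \<open>OPT + \<zeta>\<close> is at least \<open>b\<^sub>2\<close> if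
  \<open>y \<ge> b\<^sub>2\<close> and at least \<open>x\<close> otherwise; it remains to use that \<open>t / (1 - exp (- t))\<close> is increasing
  and, in the second case, that
  \<open>1 / (1 - exp (- 1 / \<lambda>)) \<le> \<lambda> / (1 - exp (- \<lambda>))\<close> for \<open>\<lambda> \<le> 1\<close>.\<close>

text \<open>Going from \<open>n\<close> to \<open>Suc n\<close> scales the old sum by
  \<open>(price - rent) / price\<close>, which removes \<open>rent * min x n\<close>. The new last
  term restores it: it is \<open>x * rent\<close> if \<open>x <= n\<close>, and
  \<open>n * rent + price\<close> otherwise.\<close>

lemma sum_geometric_cost:
  fixes rent price :: real
  assumes "price \<noteq> 0"
  shows "(\<Sum>i=1..n. ((price - rent) / price) ^ (n - i) *
           (if x < i then real x * rent else (real i - 1) * rent + price)) = price * real (min x n)"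
proof (induction n)
  case (Suc n)
  let ?c = "(price - rent) / price"
  let ?f = "\<lambda>i. if x < i then real x * rent else (real i - 1) * rent + price"
  have "(\<Sum>i=1..n. ?c ^ (Suc n - i) * ?f i) = ?c * (\<Sum>i=1..n. ?c ^ (n - i) * ?f i)"
    unfolding sum_distrib_left by (rule sum.cong) (auto simp: Suc_diff_le)
  also have "\<dots> = (price - rent) * real (min x n)"
    using assms by (simp only: Suc.IH) simp
  finally have IH: "(\<Sum>i=1..n. ?c ^ (Suc n - i) * ?f i) = (price - rent) * real (min x n)" .
  show ?case
    unfolding sum.cl_ivl_Suc IH by (cases "x \<le> n") (auto simp: algebra_simps min_def le_Suc_eq)
qed simp

lemma expected_cost_day_pmf:
  assumes "0 < r s" "r s < b s" "1 \<le> n"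
  shows "measure_pmf.expectation (map_pmf (Pair s) (day_pmf (r s) (b s) n)) (cost r b x) =
           r s * real (min x n) / (1 - (1 - r s / b s) ^ n)"
proof -
  define D where "D = 1 - (1 - r s / b s) ^ n"
  let ?f = "\<lambda>i. if x < i then real x * r s else (real i - 1) * r s + b s"
  have "measure_pmf.expectation (map_pmf (Pair s) (day_pmf (r s) (b s) n)) (cost r b x) =
      measure_pmf.expectation (day_pmf (r s) (b s) n) ?f"
    by (simp add: cost_def)
  also have "\<dots> = (\<Sum>i=1..n. ?f i * pmf (day_pmf (r s) (b s) n) i)"
    by (rule integral_measure_pmf_real) (auto simp: set_pmf_iff pmf_day_pmf[OF assms] split: if_splits)
  also have "\<dots> = (\<Sum>i=1..n. r s / (b s * D) * (((b s - r s) / b s) ^ (n - i) * ?f i))"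
    by (rule sum.cong) (simp_all add: pmf_day_pmf[OF assms] day_weight_def D_def)
  also have "\<dots> = r s / (b s * D) * (b s * real (min x n))"
    using assms unfolding sum_distrib_left[symmetric] by (subst sum_geometric_cost) auto
  finally show ?thesis
    using assms by (simp add: D_def)
qed

text \<open>This is \<open>1 - p <= exp (- p)\<close> raised to the power \<open>n\<close>;
  \<open>p <= 1\<close> keeps the base nonnegative. The slack between \<open>t\<close> and
  \<open>p * n\<close> absorbs the rounding of \<open>n\<close>.\<close>

lemma one_minus_exp_le_one_minus_power:
  fixes p :: real
  assumes "p \<le> 1" "t \<le> p * real n"
  shows "1 - exp (- t) \<le> 1 - (1 - p) ^ n"
proof -
  have "(1 - p) ^ n \<le> exp (- p) ^ n"
    using assms exp_ge_add_one_self[of "- p"] by (intro power_mono) auto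
  also have "\<dots> = exp (- (p * real n))"
    by (simp add: exp_of_nat_mult[symmetric] mult_ac)
  also have "\<dots> \<le> exp (- t)"
    using assms by simp
  finally show ?thesis by simp
qed

text \<open>By convexity of \<open>exp\<close>, its chord from \<open>- t\<close> to
  \<open>0\<close> lies above its graph at \<open>- s\<close>.\<close>

lemma divide_one_minus_exp_mono:
  fixes s t :: real
  assumes "0 < s" "s \<le> t"
  shows "s / (1 - exp (- s)) \<le> t / (1 - exp (- t))"
proof -
  have "exp ((1 - s / t) *\<^sub>R 0 + (s / t) *\<^sub>R (- t)) \<le> (1 - s / t) * exp 0 + (s / t) * exp (- t)"
    using assms by (intro convex_onD[OF exp_convex]) auto
  then have "t * exp (- s) \<le> t * (1 - s / t + s / t * exp (- t))"
    using assms by (intro mult_left_mono) auto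
  also have "\<dots> = t - s + s * exp (- t)"
    using assms by (simp add: field_simps)
  finally show ?thesis
    using assms by (simp add: frac_le_eq divide_le_0_iff) (auto simp: field_simps)
qed

text \<open>On \<open>(0, 1/2]\<close> Taylor bounds suffice; on \<open>[1/2, 1]\<close> the difference of the two sides is concave,
  nonnegative at \<open>1/2\<close> and zero at \<open>1\<close>.\<close>

lemma one_minus_exp_le_mult_inverse:
  fixes l :: real
  assumes "0 < l" "l \<le> 1"
  shows "1 - exp (- l) \<le> l * (1 - exp (- (1 / l)))"
proof -
  have small: "1 - exp (- l) \<le> l * (1 - exp (- (1 / l)))" if l: "0 < l" "l \<le> 1/2" for l :: real
  proof -
    have "1 - l + l^2/2 - l^3/6 \<le> exp (- l)"
    proof -
      obtain t where "exp (- l) = (\<Sum>m<4. (- l) ^ m / fact m) + exp t / fact 4 * (- l) ^ 4"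
        using Maclaurin_exp_le[of "- l" 4] by blast
      moreover have "0 \<le> exp t / fact 4 * (- l) ^ 4"
        by simp
      ultimately show ?thesis
        by (simp add: eval_nat_numeral)
    qed
    \<comment> \<open>Multiplied by \<open>l\<close>, the right side is exactly the slack that the
      cubic Taylor bound leaves in \<open>1 - exp (- l) <= l\<close>.\<close>
    moreover have "exp (- (1/l)) \<le> l/2 - l^2/6"
    proof -
      \<comment> \<open>The polynomial inequality below reduces to
        \<open>3 - 7 * l + 4 * l^2 - 2 * l^3 >= 0\<close>. This cubic equals 1/4 at
        \<open>l = 1/2\<close>, and subtracting 1/4 lets \<open>1/2 - l\<close> be factored
        out.\<close>
      have "0 \<le> (1/2 - l) * (2 * l^2 - 3 * l + 11/2)"
        using l by (intro mult_nonneg_nonneg) (auto simp: algebra_simps intro: order_trans[of _ "11/2"])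
      then have "0 \<le> l * ((1/2 - l) * (2 * l^2 - 3 * l + 11/2) + 1/4) / 6"
        using l by (intro divide_nonneg_nonneg mult_nonneg_nonneg) auto
      also have "\<dots> = (l/2 - l^2/6) * (2 * l^2 + 2 * l + 1) - 2 * l^2"
        by (simp add: field_simps power2_eq_square)
      finally have *: "2 * l^2 \<le> (l/2 - l^2/6) * (2 * l^2 + 2 * l + 1)"
        by (simp only: diff_ge_0_iff_ge)
      have "exp (- (1/l)) \<le> 1 / (1 + 1/l + (1/l)^2 / 2)"
        using l exp_lower_Taylor_quadratic[of "1/l"]
        by (simp add: exp_minus inverse_eq_divide frac_le add_pos_nonneg)
      also have "\<dots> = 2 * l^2 / (2 * l^2 + 2 * l + 1)"
      proof -
        have "1 + 1/l + (1/l)^2 / 2 = (2 * l^2 + 2 * l + 1) / (2 * l^2)"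
          using l by (simp add: field_simps power2_eq_square)
        then show ?thesis by simp
      qed
      also have "\<dots> \<le> l/2 - l^2/6"
        using l * by (subst pos_divide_le_eq) (auto simp: add_pos_pos)
      finally show ?thesis .
    qed
    then have "l * exp (- (1/l)) \<le> l * (l/2 - l^2/6)"
      using l by (intro mult_left_mono) auto
    ultimately show ?thesis
      by (simp add: algebra_simps power2_eq_square power3_eq_cube)
  qed
  show ?thesis
  proof (cases "l \<le> 1/2")
    case False
    let ?g = "\<lambda>x::real. 1 - exp (- x) - x * (1 - exp (- (1 / x)))"
    have "convex_on {1/2..1} ?g"
    proof (rule f''_ge0_imp_convex)
      fix x :: real assume "x \<in> {1/2..1}"
      then have x: "1/2 \<le> x" "x \<le> 1" by auto
      show "(?g has_real_derivative (exp (- x) - 1 + exp (- (1/x)) + exp (- (1/x)) / x)) (at x)"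
        using x by (auto intro!: derivative_eq_intros simp: field_simps power2_eq_square)
      show "((\<lambda>x. exp (- x) - 1 + exp (- (1/x)) + exp (- (1/x)) / x) has_real_derivative
              (exp (- (1/x)) / x^3 - exp (- x))) (at x)"
        using x by (auto intro!: derivative_eq_intros simp: field_simps power2_eq_square power3_eq_cube)
      \<comment> \<open>The logarithmic form of \<open>x^3 * exp (- x) <= exp (- (1/x))\<close>,
        that is, of a nonnegative second derivative. The left side increases up to its value 0 at 1,
        because \<open>y^2 <= y\<close> and \<open>y >= 1/2\<close> give
        \<open>3 * y - 1 - y^2 >= 0\<close>.\<close>
      have "1 / x - x + 3 * ln x \<le> 1 / 1 - 1 + 3 * ln (1::real)"
      proof (rule DERIV_nonneg_imp_nondecreasing[OF x(2)])
        fix y :: real assume y: "x \<le> y" "y \<le> 1"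
        have "((\<lambda>x. 1 / x - x + 3 * ln x) has_real_derivative ((3 * y - 1 - y^2) / y^2)) (at y)"
          using x y by (auto intro!: derivative_eq_intros simp: field_simps power2_eq_square)
        moreover have "0 \<le> 3 * y - 1 - y^2"
          using x y power_decreasing[of 1 2 y] by simp
        ultimately show "\<exists>d. ((\<lambda>x. 1 / x - x + 3 * ln x) has_real_derivative d) (at y) \<and> 0 \<le> d"
          by (meson divide_nonneg_nonneg zero_le_power2)
      qed
      then have "exp (3 * ln x - x) \<le> exp (- (1/x))"
        by simp
      moreover have "exp (3 * ln x - x) = exp (3 * ln x) * exp (- x)"
        by (simp flip: exp_add)
      moreover have "exp (3 * ln x) = x^3"
        using x exp_of_nat_mult[of 3 "ln x"] by simp
      ultimately have "exp (- x) * x^3 \<le> exp (- (1/x))"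
        by (simp only: mult.commute)
      then show "0 \<le> exp (- (1/x)) / x^3 - exp (- x)"
        using x by (simp add: pos_le_divide_eq)
    qed auto
    then have "?g l \<le> max (?g (1/2)) (?g 1)"
      using False assms by (intro convex_on_le_max) auto
    then show ?thesis
      using small[of "1/2"] by auto
  qed (use small assms in blast)
qed

theorem theorem2:
  fixes r b :: "shop \<Rightarrow> real" and lam :: real
  assumes "r Shop1 = 1" and "r Shop1 < r Shop2"
    and "b Shop1 > b Shop2" and "b Shop2 > 0"
    and "r Shop2 < b Shop2"
    and "1 / b Shop2 < lam" and "lam < 1"
  shows "(\<forall>x\<ge>1. \<forall>y. expected_cost r b (ski_alg r b lam) x y / opt b x \<le>
            min (r Shop2 * lam / (1 - exp (- (r Shop2 * lam))) * (1 + pred_error x y / opt b x))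
                (b Shop1 / b Shop2 *
                 max (r Shop2 / (1 - exp (- (r Shop2 * (lam - 1 / b Shop2)))))
                     ((1 / lam + 1 / b Shop1) / (1 - exp (- (1 / lam))))))
       \<and> consistent r b (ski_alg r b lam) (r Shop2 * lam / (1 - exp (- (r Shop2 * lam))))
       \<and> robust r b (ski_alg r b lam)
           (b Shop1 / b Shop2 *
            max (r Shop2 / (1 - exp (- (r Shop2 * (lam - 1 / b Shop2)))))
                ((1 / lam + 1 / b Shop1) / (1 - exp (- (1 / lam)))))"
proof -
  define r2 b1 b2 where "r2 = r Shop2" and "b1 = b Shop1" and "b2 = b Shop2"
  note defs = r2_def[symmetric] b1_def[symmetric] b2_def[symmetric]
  have a: "1 < r2" "b2 < b1" "r2 < b2" "1 / b2 < lam" "lam < 1"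
    using assms by (simp_all add: r2_def b1_def b2_def)
  have pos: "0 < lam" "1 < b2" "1 < b1"
    using a less_trans[of 0 "1/b2" lam] by auto
  define \<alpha> where "\<alpha> = r2 * lam / (1 - exp (- (r2 * lam)))"
  define \<beta>2 where "\<beta>2 = r2 / (1 - exp (- (r2 * (lam - 1 / b2))))"
  define \<beta>1 where "\<beta>1 = (1 / lam + 1 / b1) / (1 - exp (- (1 / lam)))"
  define E where "E = expected_cost r b (ski_alg r b lam)"
  have \<beta>: "0 \<le> \<beta>1" "0 \<le> \<beta>2"
    using a pos by (auto simp: \<beta>1_def \<beta>2_def intro!: divide_nonneg_nonneg add_nonneg_nonneg)
  \<comment> \<open>Both bounds are multiplied by \<open>opt b x\<close>, so that consistency is the
    case of zero error.\<close>
  have key: "E x y \<le> \<alpha> * (opt b x + pred_error x y) \<and> E x y \<le> b1 / b2 * max \<beta>2 \<beta>1 * opt b x"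
    if x: "1 \<le> x" for x y
  proof (cases "b2 \<le> y")
    case True
    define k where "k = nat \<lfloor>lam * b2\<rfloor>"
    have "1 < lam * b2"
      using a pos by (simp add: field_simps)
    then have k: "1 \<le> k" "real k \<le> lam * b2" "lam * b2 - 1 < real k"
      unfolding k_def by linarith+
    have E: "E x y = r2 * real (min x k) / (1 - (1 - r2 / b2) ^ k)"
      using True a k expected_cost_day_pmf[of r Shop2 b k x]
      by (simp add: E_def expected_cost_def ski_alg_def defs k_def)
    have p: "r2 / b2 \<le> 1" "0 < r2 / b2 * k"
      using a k by auto
    have "E x y \<le> r2 * k / (1 - exp (- (r2 / b2 * k)))"
      unfolding E using a p one_minus_exp_le_one_minus_power[OF p(1) order_refl, of k]
      by (intro frac_le) auto
    also have "\<dots> = b2 * (r2 / b2 * k / (1 - exp (- (r2 / b2 * k))))"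
      using pos by simp
    also have "\<dots> \<le> b2 * \<alpha>"
      unfolding \<alpha>_def using a p(2) k pos
      by (intro mult_left_mono divide_one_minus_exp_mono) (auto simp: field_simps)
    also have "\<dots> \<le> (opt b x + pred_error x y) * \<alpha>"
      using True a pos by (intro mult_right_mono) (auto simp: opt_def pred_error_def defs \<alpha>_def)
    finally have 1: "E x y \<le> \<alpha> * (opt b x + pred_error x y)"
      by (simp add: mult_ac)
    have "lam * b2 \<le> b2"
      using a pos by simp
    then have m: "real (min x k) \<le> opt b x"
      using k by (auto simp: opt_def defs)
    \<comment> \<open>The loss of \<open>1 / b2\<close> is the floor:
      \<open>k > lam * b2 - 1\<close>.\<close>
    have "r2 * (lam - 1 / b2) \<le> r2 / b2 * k"
      using a k pos mult_left_mono[of "lam * b2 - 1" k "r2 / b2"] by (simp add: right_diff_distrib)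
    from one_minus_exp_le_one_minus_power[OF p(1) this]
    have "E x y \<le> r2 * opt b x / (1 - exp (- (r2 * (lam - 1 / b2))))"
      unfolding E using a pos m by (intro frac_le mult_left_mono) (auto simp: opt_def defs)
    also have "\<dots> = 1 * \<beta>2 * opt b x"
      by (simp add: \<beta>2_def)
    also have "\<dots> \<le> b1 / b2 * max \<beta>2 \<beta>1 * opt b x"
      using a pos x \<beta> by (intro mult_mono) (auto simp: opt_def defs)
    finally show ?thesis using 1 by simp
  next
    case False
    define l where "l = nat \<lceil>b1 / lam\<rceil>"
    have "1 < b1 / lam"
      using a pos by (simp add: field_simps)
    then have l: "1 \<le> l" "b1 / lam \<le> real l" "real l \<le> b1 / lam + 1"
      unfolding l_def by linarith+
    have E: "E x y = real (min x l) / (1 - (1 - 1 / b1) ^ l)"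
      using False a l pos assms(1) expected_cost_day_pmf[of r Shop1 b l x]
      by (simp add: E_def expected_cost_def ski_alg_def defs l_def)
    have p: "1 / b1 \<le> 1" "1 / lam \<le> 1 / b1 * l"
      using a l pos by (auto simp: field_simps)
    let ?D = "1 - exp (- (1 / lam))"
    have D: "0 < ?D" using pos by simp
    have E': "E x y \<le> min x l / ?D"
      unfolding E using D one_minus_exp_le_one_minus_power[OF p] by (intro frac_le) auto
    also have "\<dots> = min x l * (1 / ?D)" by simp
    \<comment> \<open>This trades the exponent \<open>1 / lam\<close> of shop 1 for
      \<open>lam\<close>, which monotonicity then raises to the exponent \<open>r2 * lam\<close> of
      \<open>\<alpha>\<close>.\<close>
    also have "1 / ?D \<le> lam / (1 - exp (- lam))"
      using one_minus_exp_le_mult_inverse[of lam] a pos D by (simp add: field_simps)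
    also have "\<dots> \<le> \<alpha>"
      unfolding \<alpha>_def using a pos by (intro divide_one_minus_exp_mono) auto
    finally have "E x y \<le> min x l * \<alpha>" by (simp add: mult_left_mono)
    also have "\<dots> \<le> (opt b x + pred_error x y) * \<alpha>"
      using False a pos by (intro mult_right_mono) (auto simp: opt_def pred_error_def defs \<alpha>_def)
    finally have 1: "E x y \<le> \<alpha> * (opt b x + pred_error x y)"
      by (simp add: mult_ac)
    \<comment> \<open>If \<open>x <= b2\<close>, then \<open>opt b x = x\<close> and the factor is
      at least 1. Otherwise \<open>opt b x = b2\<close> and the right side is
      \<open>b1 / lam + 1\<close>, which bounds the ceiling \<open>l\<close>; this is the source of
      \<open>1 / b1\<close> in \<open>\<beta>1\<close>.\<close>
    have "real (min x l) \<le> b1 / b2 * (1 / lam + 1 / b1) * opt b x"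
    proof (cases "real x \<le> b2")
      case True
      have "1 * 1 * real x \<le> b1 / b2 * (1 / lam + 1 / b1) * real x"
        using a pos by (intro mult_mono add_increasing2) auto
      then show ?thesis using True by (simp add: opt_def defs)
    next
      case False
      have "b1 / b2 * (1 / lam + 1 / b1) * b2 = b1 / lam + 1"
        using pos by (simp add: field_simps)
      then show ?thesis using False l by (simp add: opt_def defs min_def)
    qed
    then have "min x l / ?D \<le> b1 / b2 * (1 / lam + 1 / b1) * opt b x / ?D"
      using D by (intro divide_right_mono) auto
    also have "\<dots> = b1 / b2 * \<beta>1 * opt b x"
      by (simp add: \<beta>1_def)
    also have "\<dots> \<le> b1 / b2 * max \<beta>2 \<beta>1 * opt b x"
      using a pos x \<beta> by (intro mult_right_mono mult_left_mono) (auto simp: opt_def defs)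
    finally show ?thesis using 1 E' by simp
  qed
  have o: "0 < opt b x" if "1 \<le> x" for x
    using that pos by (simp add: opt_def defs)
  have "E x y / opt b x \<le> min (\<alpha> * (1 + pred_error x y / opt b x)) (b1 / b2 * max \<beta>2 \<beta>1)"
    if "1 \<le> x" for x y
  proof -
    have "\<alpha> * (1 + pred_error x y / opt b x) = \<alpha> * (opt b x + pred_error x y) / opt b x"
      using o[OF that] by (simp add: field_simps)
    then show ?thesis
      using key[OF that, of y] o[OF that] by (auto simp: divide_right_mono pos_divide_le_eq)
  qed
  moreover have "consistent r b (ski_alg r b lam) \<alpha>"
    unfolding consistent_def E_def[symmetric] using key by (metis add.right_neutral)
  moreover have "robust r b (ski_alg r b lam) (b1 / b2 * max \<beta>2 \<beta>1)"
    unfolding robust_def E_def[symmetric] using key by blast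
  ultimately show ?thesis
    unfolding \<alpha>_def \<beta>1_def \<beta>2_def E_def r2_def b1_def b2_def by blast
qed

end
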